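(* Let $n\ge1$ and let $P$ and $Q$ be two complex polynomials of degree $n$ such that $\langle P,Q\rangle_n^{\Delta}=0$. Then $$V(P)\cap\left(V(Q)+\frac{n-1}{2}\right)\neq\emptyset.$$
   Context: $\Delta P(t)=P(t+1)-P(t)$ and $\Lambda P(t)=P(t)-P(t-1)$ are the forward and backward difference operators. For complex polynomials $A,B$ of degree at most $n$, $\langle A,B\rangle_n^{\Delta}=\sum_{p=0}^n(-1)^{n-p}\,\Delta^pA\cdot\Lambda^{n-p}B$, which is a constant polynomial, viewed as a number. For $-\infty\le a\le b\le+\infty$ put $V(a,b)=\{z\in\mathbb{C}: a\le\mathrm{Re}(z)\le b\}$. For a nonconstant polynomial $P$, $V(P)$ denotes the smallest strip $V(a,b)$ containing all roots of $P$ (so $a$ and $b$ are the minimum and maximum of the real parts of the roots). $V(Q)+c$ denotes the translate of $V(Q)$ by $c$. *)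

theory Defs
  imports "HOL-Analysis.Analysis" "HOL-Computational_Algebra.Computational_Algebra"
begin

definition fwd_diff :: "complex poly \<Rightarrow> complex poly"  (\<open>\<Delta>\<close>)
  where "\<Delta> P = P \<circ>\<^sub>p [:1, 1:] - P"

definition bwd_diff :: "complex poly \<Rightarrow> complex poly"  (\<open>\<Lambda>\<close>)
  where "\<Lambda> P = P - P \<circ>\<^sub>p [:-1, 1:]"

lemma poly_fwd_diff: "poly (\<Delta> P) t = poly P (t + 1) - poly P t"
  by (simp add: fwd_diff_def poly_pcompose add.commute)

lemma poly_bwd_diff: "poly (\<Lambda> P) t = poly P t - poly P (t - 1)"
  by (simp add: bwd_diff_def poly_pcompose)

definition diff_pairing_poly :: "nat \<Rightarrow> complex poly \<Rightarrow> complex poly \<Rightarrow> complex poly"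
  where "diff_pairing_poly n A B = (\<Sum>p=0..n. (-1) ^ (n - p) * ((\<Delta> ^^ p) A * (\<Lambda> ^^ (n - p)) B))"

text \<open>The pairing is a constant polynomial when both arguments have degree at most \<open>n\<close>
  (lemma \<open>diff_pairing_poly_const\<close> below); \<open>diff_pairing\<close> is its value.\<close>

definition diff_pairing :: "nat \<Rightarrow> complex poly \<Rightarrow> complex poly \<Rightarrow> complex"
  where "diff_pairing n A B = coeff (diff_pairing_poly n A B) 0"

lemma degree_fwd_diff:
  assumes "degree P \<le> Suc k"
  shows "degree (\<Delta> P) \<le> k"
proof (rule degree_le, intro allI impI)
  fix i assume i: "k < i"
  have d: "degree (P \<circ>\<^sub>p [:1, 1:]) = degree P" by (simp add: degree_pcompose)
  have l: "lead_coeff (P \<circ>\<^sub>p [:1, 1:]) = lead_coeff P" by (simp add: lead_coeff_comp)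
  show "coeff (\<Delta> P) i = 0"
  proof (cases "i = degree P")
    case True then show ?thesis using d l by (simp add: fwd_diff_def)
  next
    case False then have "i > degree P" using i assms by linarith
    then show ?thesis using d by (simp add: fwd_diff_def coeff_eq_0)
  qed
qed

lemma bwd_diff_conv: "\<Lambda> P = \<Delta> P \<circ>\<^sub>p [:-1, 1:]"
  by (simp add: poly_eq_poly_eq_iff[symmetric] fun_eq_iff poly_fwd_diff poly_bwd_diff poly_pcompose)

lemma fwd_diff_const: "degree P = 0 \<Longrightarrow> \<Delta> P = 0"
  by (auto simp: fwd_diff_def elim!: degree_eq_zeroE)

lemma bwd_diff_const: "degree P = 0 \<Longrightarrow> \<Lambda> P = 0"
  by (auto simp: bwd_diff_def elim!: degree_eq_zeroE)

lemma degree_bwd_diff: "degree P \<le> Suc k \<Longrightarrow> degree (\<Lambda> P) \<le> k"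
  using degree_fwd_diff[of P k] by (simp add: bwd_diff_conv degree_pcompose)

lemma fwd_diff_power_eq_0: "degree P \<le> k \<Longrightarrow> (\<Delta> ^^ Suc k) P = 0"
proof (induction k arbitrary: P)
  case (Suc k)
  then have "(\<Delta> ^^ Suc k) (\<Delta> P) = 0" by (intro Suc.IH degree_fwd_diff)
  then show ?case by (simp add: funpow_swap1)
qed (simp add: fwd_diff_const)

lemma bwd_diff_power_eq_0: "degree P \<le> k \<Longrightarrow> (\<Lambda> ^^ Suc k) P = 0"
proof (induction k arbitrary: P)
  case (Suc k)
  then have "(\<Lambda> ^^ Suc k) (\<Lambda> P) = 0" by (intro Suc.IH degree_bwd_diff)
  then show ?case by (simp add: funpow_swap1)
qed (simp add: bwd_diff_const)

lemma fwd_diff_eq_0_imp_const: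
  assumes "\<Delta> P = 0"
  shows "P = [:coeff P 0:]"
proof -
  have step: "poly P (t + 1) = poly P t" for t
    using poly_fwd_diff[of P t] assms by simp
  have "poly P (of_nat m) = poly P 0" for m
  proof (induction m)
    case (Suc m)
    then show ?case using step[of "of_nat m"] by (simp add: add.commute)
  qed simp
  then have "range of_nat \<subseteq> {t. poly (P - [:coeff P 0:]) t = 0}"
    by (auto simp: poly_0_coeff_0)
  moreover have "infinite (range (of_nat :: nat \<Rightarrow> complex))"
    by (simp add: infinite_UNIV_char_0 finite_image_iff inj_of_nat)
  ultimately have "P - [:coeff P 0:] = 0"
    using poly_roots_finite finite_subset by blast
  then show ?thesis by simp
qed

lemma diff_pairing_poly_const:
  assumes A: "degree A \<le> n" and B: "degree B \<le> n"
  shows "diff_pairing_poly n A B = [:diff_pairing n A B:]"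
proof -
  have "poly (\<Delta> (diff_pairing_poly n A B)) t = 0" for t
  proof -
    define a where "a p = poly ((\<Delta> ^^ p) A) t" for p
    define b where "b p = poly ((\<Lambda> ^^ p) B) (t + 1)" for p
    define f where "f p = (-1) ^ (n + p) * (a p * b (Suc n - p))" for p
    have a: "poly ((\<Delta> ^^ p) A) (t + 1) = a p + a (Suc p)" for p
      by (simp add: a_def poly_fwd_diff)
    have b: "poly ((\<Lambda> ^^ p) B) t = b p - b (Suc p)" for p
      by (simp add: b_def poly_bwd_diff)
    have sgn: "(-1) ^ (n - p) = ((-1) ^ (n + p) :: 'a :: comm_ring_1)" if "p \<le> n" for p
      using that by (simp add: uminus_power_if)
    have pw: "poly ((-1) ^ k) x = (-1) ^ k" for k and x :: complex by (simp add: poly_power)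
    have "poly (\<Delta> (diff_pairing_poly n A B)) t =
        (\<Sum>p=0..n. (-1) ^ (n - p) * ((a p + a (Suc p)) * b (n - p) - a p * (b (n - p) - b (Suc (n - p)))))"
      unfolding diff_pairing_poly_def poly_fwd_diff
      by (simp add: poly_sum pw a b flip: sum_subtractf a_def b_def)
         (simp add: algebra_simps a_def b_def sum.distrib sum_subtractf)
    also have "\<dots> = (\<Sum>p=0..n. f p - f (Suc p))"
      by (rule sum.cong) (auto simp: f_def sgn Suc_diff_le algebra_simps)
    also have "\<dots> = f 0 - f (Suc n)"
      using sum_telescope[of f n] by (simp add: atMost_atLeast0)
    also have "\<dots> = 0"
      unfolding f_def a_def b_def
      using fwd_diff_power_eq_0[OF A] bwd_diff_power_eq_0[OF B] by simp
    finally show ?thesis .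
  qed
  then have "\<Delta> (diff_pairing_poly n A B) = 0"
    using poly_all_0_iff_0 by blast
  then show ?thesis
    unfolding diff_pairing_def by (rule fwd_diff_eq_0_imp_const)
qed

definition strip :: "ereal \<Rightarrow> ereal \<Rightarrow> complex set"
  where "strip a b = {z. a \<le> ereal (Re z) \<and> ereal (Re z) \<le> b}"

definition root_strip :: "complex poly \<Rightarrow> complex set"
  where "root_strip P = \<Inter> {strip a b | a b. a \<le> b \<and> {z. poly P z = 0} \<subseteq> strip a b}"

text \<open>For nonconstant \<open>P\<close> this intersection is itself a strip, hence the smallest one.\<close>

lemma root_strip_eq:
  assumes "degree P > 0"
  defines "R \<equiv> Re ` {z. poly P z = 0}"
  shows "root_strip P = strip (ereal (Min R)) (ereal (Max R))" and "Min R \<le> Max R"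
    and "{z. poly P z = 0} \<subseteq> strip (ereal (Min R)) (ereal (Max R))"
proof -
  have "P \<noteq> 0" using assms by auto
  then have fin: "finite R" unfolding R_def by (intro finite_imageI poly_roots_finite)
  have "\<not> constant (poly P)" using assms by (simp add: constant_degree)
  then have ne: "R \<noteq> {}" using fundamental_theorem_of_algebra[of P] by (auto simp: R_def)
  show le: "Min R \<le> Max R" using fin ne by (meson Max_in Min_le)
  show sub: "{z. poly P z = 0} \<subseteq> strip (ereal (Min R)) (ereal (Max R))"
    using fin by (auto simp: strip_def R_def)
  have "strip (ereal (Min R)) (ereal (Max R)) \<subseteq> strip a b"
    if "{z. poly P z = 0} \<subseteq> strip a b" for a b
  proof -
    have "a \<le> ereal r \<and> ereal r \<le> b" if "r \<in> R" for r
      using that \<open>_ \<subseteq> strip a b\<close> by (auto simp: R_def strip_def)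
    then have "a \<le> ereal (Min R)" "ereal (Max R) \<le> b" using fin ne by auto
    then show ?thesis unfolding strip_def by (blast intro: order_trans)
  qed
  then show "root_strip P = strip (ereal (Min R)) (ereal (Max R))"
    unfolding root_strip_def using sub le ereal_less_eq(3)[of "Min R" "Max R"]
    by (intro equalityI Inter_lower Inter_greatest) blast+
qed

end

theory Submission
  imports Defs
begin

text \<open>If the two strips are disjoint, a vertical line separates them, and we show by induction on
  \<open>n\<close> that the pairing does not vanish. Split off a root, \<open>Q = (t - w) Q\<^sub>1\<close>. Evaluating the
  (constant) pairings at \<open>w\<close> and \<open>w - 1\<close> gives \<open>\<langle>P, Q\<rangle>\<^sub>n = - \<langle>R, Q\<^sub>1\<rangle>\<^sub>n\<^sub>-\<^sub>1\<close> with
  \<open>R(t) = n P(t + 1) - (t - w + 1) \<Delta>P(t)\<close>. As in Laguerre's theorem on polar derivatives, \<open>R\<close> has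
  degree \<open>n - 1\<close> and its roots lie in the half-plane of those of \<open>P\<close> moved left by \<open>1/2\<close>, which
  is exactly the change of \<open>(n - 1)/2\<close>. The root location rests on the inequality
  \<open>|1 - uv|\<^sup>2/(1 - |uv|\<^sup>2) \<le> |1 - u|\<^sup>2/(1 - |u|\<^sup>2) + |1 - v|\<^sup>2/(1 - |v|\<^sup>2)\<close> in the unit disc,
  applied to the factors \<open>(t - r)/(t + 1 - r)\<close> of \<open>P(t)/P(t + 1)\<close>.\<close>

section \<open>Comparing the values of a polynomial at two points\<close>

text \<open>The third claim is the disc inequality above, summed over the roots and cleared of
  denominators.\<close>

lemma poly_shift_diff_bound:
  fixes P :: "complex poly" and x y :: complex and d :: real
  assumes "P \<noteq> 0" and "d > 0"
    and "\<And>r. poly P r = 0 \<Longrightarrow> d \<le> (cmod (x - r))\<^sup>2 - (cmod (y - r))\<^sup>2"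
  shows "poly P x \<noteq> 0"
    and "degree P > 0 \<Longrightarrow> cmod (poly P y) < cmod (poly P x)"
    and "d * (cmod (poly P x - poly P y))\<^sup>2
      \<le> degree P * (cmod (x - y))\<^sup>2 * ((cmod (poly P x))\<^sup>2 - (cmod (poly P y))\<^sup>2)"
proof -
  have "poly P x \<noteq> 0 \<and> (degree P > 0 \<longrightarrow> cmod (poly P y) < cmod (poly P x)) \<and>
      d * (cmod (poly P x - poly P y))\<^sup>2
      \<le> degree P * (cmod (x - y))\<^sup>2 * ((cmod (poly P x))\<^sup>2 - (cmod (poly P y))\<^sup>2)"
    using assms
  proof (induction "degree P" arbitrary: P)
    case 0
    then obtain a where "P = [:a:]" by (metis degree_eq_zeroE)
    with 0 show ?case by simp
  next
    case (Suc k)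
    have "\<not> constant (poly P)" using Suc.hyps(2) by (simp add: constant_degree)
    then obtain r where r: "poly P r = 0"
      using fundamental_theorem_of_algebra by blast
    then obtain P1 where P: "P = [:- r, 1:] * P1"
      by (auto simp: poly_eq_0_iff_dvd elim: dvdE)
    with Suc.prems have P1: "P1 \<noteq> 0" by auto
    then have deg: "degree P1 = k" using Suc.hyps(2) by (simp add: P degree_mult_eq del: mult_pCons_left)
    have IH: "poly P1 x \<noteq> 0" "k > 0 \<Longrightarrow> cmod (poly P1 y) < cmod (poly P1 x)"
      "d * (cmod (poly P1 x - poly P1 y))\<^sup>2
        \<le> k * (cmod (x - y))\<^sup>2 * ((cmod (poly P1 x))\<^sup>2 - (cmod (poly P1 y))\<^sup>2)"
      using Suc.hyps(1)[of P1] deg P1 Suc.prems by (auto simp: P)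
    define a b A B h where "a = cmod (x - r)" and "b = cmod (y - r)"
      and "A = cmod (poly P1 x)" and "B = cmod (poly P1 y)" and "h = cmod (x - y)"
    define E where "E = cmod (poly P1 x - poly P1 y)"
    have ab: "d \<le> a\<^sup>2 - b\<^sup>2" using Suc.prems(3)[OF r] by (simp add: a_def b_def)
    have nn: "a \<ge> 0" "b \<ge> 0" "A \<ge> 0" "B \<ge> 0" "h \<ge> 0" "E \<ge> 0"
      by (simp_all add: a_def b_def A_def B_def h_def E_def)
    have "b\<^sup>2 < a\<^sup>2" using ab Suc.prems(2) by linarith
    then have ba: "b < a" using nn by (simp add: power2_less_imp_less)
    have A: "A > 0" using IH(1) by (simp add: A_def)
    have BA: "B \<le> A"
    proof (cases "k = 0")
      case True
      then show ?thesis using deg by (auto simp: A_def B_def elim!: degree_eq_zeroE)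
    next
      case False
      then show ?thesis using IH(2) by (simp add: A_def B_def)
    qed
    have P_eq: "poly P z = (z - r) * poly P1 z" for z by (simp add: P algebra_simps)
    have Px: "cmod (poly P x) = a * A" and Py: "cmod (poly P y) = b * B"
      by (simp_all add: P_eq a_def b_def A_def B_def norm_mult)
    have 1: "b * B < a * A"
      using ba BA A nn by (meson mult_left_mono mult_strict_right_mono order_le_less_trans)
    have "poly P x - poly P y = (x - r) * (poly P1 x - poly P1 y) + (x - y) * poly P1 y"
      by (simp add: P_eq algebra_simps)
    then have "cmod (poly P x - poly P y) \<le> a * E + h * B"
      by (metis norm_triangle_ineq norm_mult a_def E_def h_def B_def)
    then have "d * (cmod (poly P x - poly P y))\<^sup>2 \<le> d * (a * E + h * B)\<^sup>2"
      using Suc.prems(2) by (intro mult_left_mono power_mono) auto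
    also have "\<dots> \<le> Suc k * h\<^sup>2 * (a\<^sup>2 * (A\<^sup>2 - B\<^sup>2) + d * B\<^sup>2)"
    proof (cases "k = 0")
      case True
      then have "E = 0" using deg by (auto simp: E_def elim!: degree_eq_zeroE)
      moreover have "A\<^sup>2 - B\<^sup>2 \<ge> 0" using BA nn by (simp add: power_mono)
      ultimately show ?thesis using True by (simp add: power_mult_distrib algebra_simps mult_right_mono)
    next
      case False
      have "a\<^sup>2 * (d * E\<^sup>2) \<le> a\<^sup>2 * (k * h\<^sup>2 * (A\<^sup>2 - B\<^sup>2))"
        using IH(3) by (intro mult_left_mono) (simp_all add: E_def A_def B_def h_def)
      then have X: "d * (a * E)\<^sup>2 \<le> k * (h\<^sup>2 * a\<^sup>2 * (A\<^sup>2 - B\<^sup>2))"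
        by (simp add: power_mult_distrib algebra_simps)
      \<comment> \<open>Weighted Cauchy-Schwarz, with the defect written as a square; the weights
        reflect the \<open>k\<close> roots of \<open>P1\<close> against the single root split
        off.\<close>
      have "Suc k * ((a * E)\<^sup>2 + k * (h * B)\<^sup>2) - k * (a * E + h * B)\<^sup>2 = (a * E - k * (h * B))\<^sup>2"
        by (simp add: power2_eq_square algebra_simps)
      then have "k * (a * E + h * B)\<^sup>2 \<le> Suc k * ((a * E)\<^sup>2 + k * (h * B)\<^sup>2)"
        by (smt (verit) zero_le_power2)
      then have "d * (k * (a * E + h * B)\<^sup>2) \<le> d * (Suc k * ((a * E)\<^sup>2 + k * (h * B)\<^sup>2))"
        using Suc.prems(2) by (intro mult_left_mono) auto
      also have "\<dots> = Suc k * (d * (a * E)\<^sup>2 + k * (d * (h * B)\<^sup>2))"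
        by (simp add: algebra_simps)
      also have "\<dots> \<le> Suc k * (k * (h\<^sup>2 * a\<^sup>2 * (A\<^sup>2 - B\<^sup>2)) + k * (d * (h * B)\<^sup>2))"
        using X by (intro mult_left_mono add_right_mono) auto
      also have "\<dots> = k * (Suc k * h\<^sup>2 * (a\<^sup>2 * (A\<^sup>2 - B\<^sup>2) + d * B\<^sup>2))"
        by (simp add: power_mult_distrib algebra_simps)
      finally have "k * (d * (a * E + h * B)\<^sup>2) \<le> k * (Suc k * h\<^sup>2 * (a\<^sup>2 * (A\<^sup>2 - B\<^sup>2) + d * B\<^sup>2))"
        by (simp add: mult.left_commute)
      then show ?thesis using False by (subst (asm) mult_le_cancel_left_pos) auto
    qed
    \<comment> \<open>Replacing \<open>d\<close> by the gap \<open>a\<^sup>2 - b\<^sup>2\<close> of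
      the root \<open>r\<close> makes the terms in \<open>a\<^sup>2 * B\<^sup>2\<close> cancel,
      which leaves the gap for \<open>P\<close> itself.\<close>
    also have "\<dots> \<le> Suc k * h\<^sup>2 * (a\<^sup>2 * (A\<^sup>2 - B\<^sup>2) + (a\<^sup>2 - b\<^sup>2) * B\<^sup>2)"
      using ab by (intro mult_left_mono add_left_mono mult_right_mono) auto
    also have "\<dots> = Suc k * h\<^sup>2 * ((a * A)\<^sup>2 - (b * B)\<^sup>2)"
      by (simp add: power_mult_distrib algebra_simps)
    finally have "d * (cmod (poly P x - poly P y))\<^sup>2 \<le> Suc k * h\<^sup>2 * ((a * A)\<^sup>2 - (b * B)\<^sup>2)" .
    moreover have "poly P x \<noteq> 0" using Px A ba nn by auto
    ultimately show ?case
      using 1 unfolding Px Py Suc.hyps(2)[symmetric] h_def[symmetric] by blast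
  qed
  then show "poly P x \<noteq> 0"
    and "degree P > 0 \<Longrightarrow> cmod (poly P y) < cmod (poly P x)"
    and "d * (cmod (poly P x - poly P y))\<^sup>2
      \<le> degree P * (cmod (x - y))\<^sup>2 * ((cmod (poly P x))\<^sup>2 - (cmod (poly P y))\<^sup>2)"
    by blast+
qed

lemma cmod_add_1_diff: "(cmod (z + 1))\<^sup>2 - (cmod z)\<^sup>2 = 2 * Re z + 1"
  unfolding cmod_power2 by (simp add: power2_eq_square algebra_simps)

text \<open>Choosing \<open>s = 1\<close> or \<open>s = -1\<close> treats left and right half-planes simultaneously.\<close>

lemma poly_add_1_bounds:
  fixes P :: "complex poly" and s c :: real and t :: complex
  assumes "P \<noteq> 0" and s: "s = 1 \<or> s = -1"
    and roots: "\<And>r. poly P r = 0 \<Longrightarrow> s * (Re r - c) \<le> 0"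
  defines "\<delta> \<equiv> s * (Re t - (c - 1/2))"
  assumes "\<delta> > 0"
  shows "degree P > 0 \<Longrightarrow> poly P (t + 1) \<noteq> poly P t"
    and "2 * \<delta> * (cmod (poly P (t + 1) - poly P t))\<^sup>2
      \<le> degree P * (s * ((cmod (poly P (t + 1)))\<^sup>2 - (cmod (poly P t))\<^sup>2))"
    and "poly P (t + 1) \<noteq> 0 \<or> poly P t \<noteq> 0"
proof -
  \<comment> \<open>The gap is \<open>s * (2 * Re (t - r) + 1)\<close>; its worst case is a root on
    the boundary \<open>Re r = c\<close>, where it equals \<open>2 * \<delta>\<close>.\<close>
  have d: "2 * \<delta> \<le> s * ((cmod (t + 1 - r))\<^sup>2 - (cmod (t - r))\<^sup>2)" if "poly P r = 0" for r
    using cmod_add_1_diff[of "t - r"] roots[OF that] s by (auto simp: \<delta>_def algebra_simps)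
  have pos: "2 * \<delta> > 0" using \<open>\<delta> > 0\<close> by simp
  consider "s = 1" | "s = -1" using s by blast
  then have "(degree P > 0 \<longrightarrow> poly P (t + 1) \<noteq> poly P t) \<and>
    2 * \<delta> * (cmod (poly P (t + 1) - poly P t))\<^sup>2
      \<le> degree P * (s * ((cmod (poly P (t + 1)))\<^sup>2 - (cmod (poly P t))\<^sup>2)) \<and>
    (poly P (t + 1) \<noteq> 0 \<or> poly P t \<noteq> 0)"
  proof cases
    case 1
    then show ?thesis
      using poly_shift_diff_bound[OF \<open>P \<noteq> 0\<close> pos, of "t + 1" t] d by fastforce
  next
    case 2
    \<comment> \<open>For \<open>s = -1\<close> the points \<open>t\<close> and \<open>t + 1\<close>
      exchange roles.\<close>
    then have d': "2 * \<delta> \<le> (cmod (t - r))\<^sup>2 - (cmod (t + 1 - r))\<^sup>2" if "poly P r = 0" for r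
      using d[OF that] by simp
    show ?thesis
      using poly_shift_diff_bound[OF \<open>P \<noteq> 0\<close> pos d'] 2
      by (auto simp: norm_minus_commute)
  qed
  then show "degree P > 0 \<Longrightarrow> poly P (t + 1) \<noteq> poly P t"
    and "2 * \<delta> * (cmod (poly P (t + 1) - poly P t))\<^sup>2
      \<le> degree P * (s * ((cmod (poly P (t + 1)))\<^sup>2 - (cmod (poly P t))\<^sup>2))"
    and "poly P (t + 1) \<noteq> 0 \<or> poly P t \<noteq> 0"
    by blast+
qed

section \<open>Degrees under shifts and differences\<close>

lemma degree_pcompose_shift: "degree (P \<circ>\<^sub>p [:a, 1:]) = degree (P :: complex poly)"
  by (simp add: degree_pcompose)

text \<open>Only the terms of degree \<open>k\<close> and \<open>Suc k\<close> contribute. The extra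
  summand is the leading coefficient of the difference, whose degree therefore drops by exactly
  one.\<close>

lemma coeff_pcompose_shift:
  assumes "degree (P :: complex poly) \<le> Suc k"
  shows "coeff (P \<circ>\<^sub>p [:1, 1:]) k = coeff P k + of_nat (Suc k) * coeff P (Suc k)"
  using assms
proof (induction P arbitrary: k)
  case (pCons a p)
  have top: "coeff (p \<circ>\<^sub>p [:1, 1:]) k = coeff p k"
  proof (cases "degree p = k")
    case True
    have "lead_coeff (p \<circ>\<^sub>p [:1, 1:]) = lead_coeff p" by (simp add: lead_coeff_comp)
    then show ?thesis using True by (simp add: degree_pcompose_shift)
  next
    case False
    then show ?thesis
      using pCons.prems by (cases "p = 0") (auto simp: coeff_eq_0 degree_pcompose_shift)
  qed
  show ?case
  proof (cases k)
    case 0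
    then show ?thesis using top by (simp add: pcompose_pCons)
  next
    case (Suc j)
    then have "coeff (p \<circ>\<^sub>p [:1, 1:]) j = coeff p j + of_nat (Suc j) * coeff p (Suc j)"
      using pCons.prems by (intro pCons.IH) (auto split: if_splits)
    then show ?thesis using top Suc by (simp add: pcompose_pCons algebra_simps)
  qed
qed simp

lemma degree_fwd_diff_eq: "degree (\<Delta> P) = degree P - 1"
proof (cases "degree P")
  case 0
  then show ?thesis by (simp add: fwd_diff_const)
next
  case (Suc k)
  then have "coeff P (Suc k) \<noteq> 0" by (metis leading_coeff_0_iff degree_0 nat.distinct(1))
  then have "coeff (\<Delta> P) k \<noteq> 0"
    using coeff_pcompose_shift[of P k] Suc by (simp add: fwd_diff_def del: of_nat_Suc)
  then show ?thesis
    using degree_fwd_diff[of P k] Suc by (simp add: le_antisym le_degree)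
qed

lemma degree_fwd_diff_power: "degree ((\<Delta> ^^ k) P) = degree P - k"
  by (induction k) (simp_all add: degree_fwd_diff_eq)

section \<open>Half-planes containing the roots of differences\<close>

text \<open>A Gauss-Lucas theorem for differences: past the moved boundary, every root is strictly
  closer to the same one of \<open>t\<close> and \<open>t + 1\<close>, so the two values of
  \<open>P\<close> differ in modulus.\<close>

lemma fwd_diff_roots:
  assumes "s = 1 \<or> s = -1" and "degree P > 0"
    and "\<And>r. poly P r = 0 \<Longrightarrow> s * (Re r - c) \<le> 0"
    and "poly (\<Delta> P) t = 0"
  shows "s * (Re t - (c - 1/2)) \<le> 0"
proof (rule ccontr)
  assume "\<not> ?thesis"
  moreover have "P \<noteq> 0" using assms(2) by auto
  ultimately have "poly P (t + 1) \<noteq> poly P t"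
    using poly_add_1_bounds(1)[OF _ assms(1,3), where t = t] assms(2) by (simp add: not_le)
  then show False using assms(4) by (simp add: poly_fwd_diff)
qed

lemma fwd_diff_power_roots:
  assumes s: "s = 1 \<or> s = -1" and "k < degree P"
    and "\<And>r. poly P r = 0 \<Longrightarrow> s * (Re r - c) \<le> 0"
    and "poly ((\<Delta> ^^ k) P) t = 0"
  shows "s * (Re t - (c - k / 2)) \<le> 0"
  using assms(2,4)
proof (induction k arbitrary: t)
  case 0
  then show ?case using assms(3) by simp
next
  case (Suc k)
  then have "s * (Re t - (c - k / 2 - 1/2)) \<le> 0"
    by (intro fwd_diff_roots[OF s, of "(\<Delta> ^^ k) P"]) (auto simp: degree_fwd_diff_power)
  then show ?case by (simp add: field_simps)
qed

section \<open>Polar differences: degree and roots\<close>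

text \<open>The difference analogue of the polar derivative \<open>n P - (t - w) P'\<close> of Laguerre.\<close>

definition polar_diff :: "complex \<Rightarrow> complex \<Rightarrow> complex poly \<Rightarrow> complex poly"
  where "polar_diff m w P = smult m (P \<circ>\<^sub>p [:1, 1:]) - [:1 - w, 1:] * \<Delta> P"

lemma poly_polar_diff:
  "poly (polar_diff m w P) t = m * poly P (t + 1) - (t - w + 1) * poly (\<Delta> P) t"
  by (simp add: polar_diff_def poly_pcompose algebra_simps)

text \<open>By the product rule, differencing the linear factor uses up one copy of the shifted
  term.\<close>

lemma fwd_diff_polar_diff: "\<Delta> (polar_diff m w P) = polar_diff (m - 1) w (\<Delta> P)"
  by (simp add: poly_eq_poly_eq_iff[symmetric] fun_eq_iff poly_polar_diff poly_fwd_diff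
      algebra_simps)

lemma fwd_diff_power_polar_diff:
  "(\<Delta> ^^ p) (polar_diff m w P) = polar_diff (m - of_nat p) w ((\<Delta> ^^ p) P)"
  by (induction p) (simp_all add: fwd_diff_polar_diff algebra_simps)

lemma poly_fwd_diff_power_polar_diff:
  "poly ((\<Delta> ^^ p) (polar_diff m w P)) (w - 1) = (m - of_nat p) * poly ((\<Delta> ^^ p) P) w"
  by (simp add: fwd_diff_power_polar_diff poly_polar_diff)

text \<open>After \<open>Suc k\<close> differences the parameter has dropped to zero, and the
  remaining term contains a vanishing difference of \<open>P\<close>.\<close>

lemma degree_polar_diff_le:
  assumes "degree P \<le> Suc k"
  shows "degree (polar_diff (of_nat (Suc k)) w P) \<le> k"
proof -
  let ?R = "polar_diff (of_nat (Suc k)) w P"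
  have "(\<Delta> ^^ Suc (Suc k)) P = 0" using assms by (rule fwd_diff_power_eq_0)
  then have "(\<Delta> ^^ Suc k) ?R = 0"
    unfolding fwd_diff_power_polar_diff by (simp add: polar_diff_def)
  then have "\<Delta> ((\<Delta> ^^ k) ?R) = 0" by simp
  then have "degree ((\<Delta> ^^ k) ?R) = 0" by (metis fwd_diff_eq_0_imp_const degree_pCons_0)
  then show ?thesis by (simp add: degree_fwd_diff_power)
qed

text \<open>The \<open>k\<close>-th difference at \<open>w - 1\<close> has weight one, so it equals
  that of \<open>P\<close> at \<open>w\<close>. This is nonzero because \<open>w\<close> lies
  outside the half-plane, moved by \<open>k / 2\<close>, that holds the roots of the
  \<open>k\<close>-th difference of \<open>P\<close>.\<close>

lemma degree_polar_diff:
  assumes s: "s = 1 \<or> s = -1" and P: "degree P = Suc k"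
    and roots: "\<And>r. poly P r = 0 \<Longrightarrow> s * (Re r - c) \<le> 0"
    and w: "s * (Re w - (c - k / 2)) > 0"
  shows "degree (polar_diff (of_nat (Suc k)) w P) = k"
    and "polar_diff (of_nat (Suc k)) w P \<noteq> 0"
proof -
  let ?R = "polar_diff (of_nat (Suc k)) w P"
  have "poly ((\<Delta> ^^ k) P) w \<noteq> 0"
    using fwd_diff_power_roots[OF s _ roots, of k P w] P w by auto
  then have ne: "(\<Delta> ^^ k) ?R \<noteq> 0"
    using poly_fwd_diff_power_polar_diff[of k "of_nat (Suc k)" w P] by auto
  have "(\<Delta> ^^ k) 0 = 0" by (induction k) (auto simp: fwd_diff_const)
  then show "?R \<noteq> 0" using ne by auto
  have "k \<le> degree ?R"
  proof (rule ccontr)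
    assume "\<not> k \<le> degree ?R"
    then obtain j where "k = Suc j" "degree ?R \<le> j" by (cases k) auto
    then show False using ne fwd_diff_power_eq_0 by auto
  qed
  then show "degree ?R = k" using degree_polar_diff_le[of P k w] P by simp
qed

text \<open>At a root \<open>t\<close>, both \<open>P(t + 1)\<close> and \<open>P(t)\<close> are
  multiples of their difference, so the gap of their squared moduli is explicit. In the comparison
  with the lower bound \<open>Re t\<close> cancels, and what remains contradicts the position of
  \<open>w\<close>.\<close>

lemma polar_diff_roots:
  assumes s: "s = 1 \<or> s = -1" and n: "degree P = n" "n > 0"
    and roots: "\<And>r. poly P r = 0 \<Longrightarrow> s * (Re r - c) \<le> 0"
    and w: "s * (Re w - (c - (real n - 1) / 2)) > 0"
    and t: "poly (polar_diff (of_nat n) w P) t = 0"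
  shows "s * (Re t - (c - 1/2)) \<le> 0"
proof (rule ccontr)
  define \<delta> where "\<delta> = s * (Re t - (c - 1/2))"
  assume "\<not> ?thesis"
  then have \<delta>: "\<delta> > 0" by (simp add: \<delta>_def)
  define A B m where "A = poly P (t + 1)" and "B = poly P t" and "m = t - w + 1"
  have "P \<noteq> 0" using n by auto
  note bounds = poly_add_1_bounds[OF this s roots \<delta>[unfolded \<delta>_def], folded \<delta>_def A_def B_def, unfolded n(1)]
  have AB: "A \<noteq> B" using bounds(1) n by simp
  have A: "of_nat n * A = m * (A - B)"
    using t by (simp add: poly_polar_diff poly_fwd_diff A_def B_def m_def)
  then have B: "of_nat n * B = (m - of_nat n) * (A - B)"
    by (simp add: algebra_simps)
  define e where "e = (cmod (A - B))\<^sup>2"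
  have e: "e > 0" using AB by (simp add: e_def)
  have "(n * cmod A)\<^sup>2 = (cmod m)\<^sup>2 * e"
    using arg_cong[OF A, of cmod] by (simp add: norm_mult e_def power_mult_distrib)
  moreover have "(n * cmod B)\<^sup>2 = (cmod (m - of_nat n))\<^sup>2 * e"
    using arg_cong[OF B, of cmod] by (simp add: norm_mult e_def power_mult_distrib)
  ultimately have "n * (n * ((cmod A)\<^sup>2 - (cmod B)\<^sup>2)) = ((cmod m)\<^sup>2 - (cmod (m - of_nat n))\<^sup>2) * e"
    by (simp add: power_mult_distrib power2_eq_square algebra_simps)
  also have "(cmod m)\<^sup>2 - (cmod (m - of_nat n))\<^sup>2 = n * (2 * Re m - n)"
    unfolding cmod_power2 by (simp add: power2_eq_square algebra_simps)
  finally have "n * ((cmod A)\<^sup>2 - (cmod B)\<^sup>2) = (2 * Re m - n) * e"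
    using n by simp
  then have "n * (s * ((cmod A)\<^sup>2 - (cmod B)\<^sup>2)) = s * (2 * Re m - n) * e"
    by (simp add: mult.left_commute mult.assoc)
  with bounds(2) have "2 * \<delta> * e \<le> s * (2 * Re m - n) * e" by (simp add: e_def)
  then have "2 * \<delta> \<le> s * (2 * Re m - n)" using e by simp
  then show False using w s by (auto simp: \<delta>_def m_def field_simps)
qed

section \<open>Removing a linear factor from the pairing\<close>

lemma poly_bwd_diff_power_Suc:
  "poly ((\<Lambda> ^^ Suc m) Q) t = poly ((\<Lambda> ^^ m) Q) t - poly ((\<Lambda> ^^ m) Q) (t - 1)"
  by (simp add: poly_bwd_diff)

text \<open>Leibniz rule, where higher differences of the linear factor vanish. At
  \<open>m = 0\<close> the truncated \<open>m - 1\<close> is harmless, as its coefficient is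
  zero.\<close>

lemma poly_bwd_diff_power_linear_mult:
  "poly ((\<Lambda> ^^ m) ([:- w, 1:] * Q)) t =
    (t - w) * poly ((\<Lambda> ^^ m) Q) t + of_nat m * poly ((\<Lambda> ^^ (m - 1)) Q) (t - 1)"
proof (induction m arbitrary: t)
  case 0
  then show ?case by (simp add: algebra_simps)
next
  case (Suc m)
  have "of_nat m * poly ((\<Lambda> ^^ m) Q) (t - 1) =
    of_nat m * (poly ((\<Lambda> ^^ (m - 1)) Q) (t - 1) - poly ((\<Lambda> ^^ (m - 1)) Q) (t - 1 - 1))"
    by (cases m) (simp_all add: poly_bwd_diff)
  then show ?case
    unfolding poly_bwd_diff_power_Suc Suc by (simp add: algebra_simps)
qed

lemma diff_pairing_eq:
  assumes "degree A \<le> n" and "degree B \<le> n"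
  shows "diff_pairing n A B =
    (\<Sum>p\<le>n. (-1) ^ (n - p) * (poly ((\<Delta> ^^ p) A) t * poly ((\<Lambda> ^^ (n - p)) B) t))"
proof -
  have "diff_pairing n A B = poly (diff_pairing_poly n A B) t"
    using diff_pairing_poly_const[OF assms] by simp
  then show ?thesis by (simp add: diff_pairing_poly_def poly_sum poly_power atMost_atLeast0)
qed

text \<open>Evaluating the left pairing at \<open>w\<close> and the right one at
  \<open>w - 1\<close> kills a linear factor in each and leaves the same weights
  \<open>Suc k - p\<close>. The term \<open>p = Suc k\<close> drops out, and the lost sign factor
  gives the minus.\<close>

lemma diff_pairing_linear_mult:
  assumes P: "degree P \<le> Suc k" and Q: "degree Q \<le> k"
  shows "diff_pairing (Suc k) P ([:- w, 1:] * Q) = - diff_pairing k (polar_diff (of_nat (Suc k)) w P) Q"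
proof -
  have "degree ([:- w, 1:] * Q) \<le> Suc k"
    using degree_mult_le[of "[:- w, 1:]" Q] Q by simp
  then have "diff_pairing (Suc k) P ([:- w, 1:] * Q) =
    (\<Sum>p\<le>Suc k. (-1) ^ (Suc k - p) * (poly ((\<Delta> ^^ p) P) w *
      (of_nat (Suc k - p) * poly ((\<Lambda> ^^ (Suc k - p - 1)) Q) (w - 1))))"
    using diff_pairing_eq[OF P, of "[:- w, 1:] * Q" w]
    unfolding poly_bwd_diff_power_linear_mult by simp
  also have "\<dots> = - (\<Sum>p\<le>k. (-1) ^ (k - p) *
      (poly ((\<Delta> ^^ p) (polar_diff (of_nat (Suc k)) w P)) (w - 1) * poly ((\<Lambda> ^^ (k - p)) Q) (w - 1)))"
    by (simp add: poly_fwd_diff_power_polar_diff sum_negf[symmetric] Suc_diff_le of_nat_diff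
        del: of_nat_Suc)
       (rule sum.cong, auto simp: of_nat_diff algebra_simps)
  also have "\<dots> = - diff_pairing k (polar_diff (of_nat (Suc k)) w P) Q"
    using diff_pairing_eq[OF degree_polar_diff_le[OF P] Q] by simp
  finally show ?thesis .
qed

section \<open>Separated strips and nonvanishing of the pairing\<close>

text \<open>The threshold \<open>c - (n - 1) / 2\<close> is unchanged when \<open>n\<close> drops by
  one and \<open>c\<close> by \<open>1/2\<close>, so the condition on the roots of \<open>Q\<close>
  passes directly to the cofactor.\<close>

lemma diff_pairing_nonzero:
  assumes s: "s = 1 \<or> s = -1"
    and "degree P = n" "degree Q = n" "P \<noteq> 0" "Q \<noteq> 0"
    and "\<And>r. poly P r = 0 \<Longrightarrow> s * (Re r - c) \<le> 0"
    and "\<And>w. poly Q w = 0 \<Longrightarrow> s * (Re w - (c - (real n - 1) / 2)) > 0"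
  shows "diff_pairing n P Q \<noteq> 0"
  using assms(2-)
proof (induction n arbitrary: P Q c)
  case 0
  then show ?case
    by (auto simp: diff_pairing_def diff_pairing_poly_def elim!: degree_eq_zeroE)
next
  case (Suc k)
  have "\<not> constant (poly Q)" using Suc.prems by (simp add: constant_degree)
  then obtain w where w: "poly Q w = 0"
    using fundamental_theorem_of_algebra by blast
  then obtain Q1 where Q: "Q = [:- w, 1:] * Q1"
    by (auto simp: poly_eq_0_iff_dvd elim: dvdE)
  with Suc.prems have Q1: "Q1 \<noteq> 0" by auto
  then have deg: "degree Q1 = k"
    using Suc.prems(2) by (simp add: Q degree_mult_eq del: mult_pCons_left)
  let ?R = "polar_diff (of_nat (Suc k)) w P"
  have w': "s * (Re w - (c - k / 2)) > 0" using Suc.prems(6)[OF w] by simp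
  have "diff_pairing k ?R Q1 \<noteq> 0"
  proof (rule Suc.IH)
    show "degree ?R = k" "?R \<noteq> 0"
      using degree_polar_diff[OF s Suc.prems(1,5) w'] by auto
    show "s * (Re t - (c - 1/2)) \<le> 0" if "poly ?R t = 0" for t
      using polar_diff_roots[OF s Suc.prems(1) _ Suc.prems(5) _ that] w' by simp
    show "s * (Re v - (c - 1/2 - (real k - 1) / 2)) > 0" if "poly Q1 v = 0" for v
      using Suc.prems(6)[of v] that by (simp add: Q field_simps)
  qed (use deg Q1 in auto)
  then show ?case
    using diff_pairing_linear_mult[of P k Q1 w] Suc.prems(1) deg by (simp add: Q)
qed

theorem theorem1p8:
  fixes n :: nat and P Q :: "complex poly"
  assumes "n \<ge> 1"
    and "degree P = n" and "degree Q = n"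
    and "diff_pairing n P Q = 0"
  shows "root_strip P \<inter> (\<lambda>z. z + (of_nat n - 1) / 2) ` root_strip Q \<noteq> {}"
proof
  assume empty: "root_strip P \<inter> (\<lambda>z. z + (of_nat n - 1) / 2) ` root_strip Q = {}"
  define a b where "a = Min (Re ` {z. poly P z = 0})" and "b = Max (Re ` {z. poly P z = 0})"
  define a' b' where "a' = Min (Re ` {z. poly Q z = 0})" and "b' = Max (Re ` {z. poly Q z = 0})"
  have "degree P > 0" "degree Q > 0" using assms by auto
  note P = root_strip_eq[OF this(1), folded a_def b_def]
    and Q = root_strip_eq[OF this(2), folded a'_def b'_def]
  have rP: "a \<le> Re r \<and> Re r \<le> b" if "poly P r = 0" for r
    using P(3) that by (auto simp: strip_def)
  have rQ: "a' \<le> Re r \<and> Re r \<le> b'" if "poly Q r = 0" for r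
    using Q(3) that by (auto simp: strip_def)
  have nz: "P \<noteq> 0" "Q \<noteq> 0" using assms by auto
  let ?h = "(real n - 1) / 2"
  consider "b < a' + ?h" | "b' + ?h < a" | "max a (a' + ?h) \<le> min b (b' + ?h)"
    using P(2) Q(2) by linarith
  then show False
  proof cases
    case 1
    have "diff_pairing n P Q \<noteq> 0"
    proof (rule diff_pairing_nonzero[where s = 1 and c = b])
      show "1 * (Re r - b) \<le> 0" if "poly P r = 0" for r
        using rP[OF that] by simp
      show "1 * (Re w - (b - ?h)) > 0" if "poly Q w = 0" for w
        using rQ[OF that] 1 by simp
    qed (use assms nz in auto)
    then show False using assms by simp
  next
    case 2
    have "diff_pairing n P Q \<noteq> 0"
    \<comment> \<open>Now the roots of \<open>P\<close> lie to the right of the separating line, so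
      the sign is reversed.\<close>
    proof (rule diff_pairing_nonzero[where s = "-1" and c = a])
      show "-1 * (Re r - a) \<le> 0" if "poly P r = 0" for r
        using rP[OF that] by simp
      show "-1 * (Re w - (a - ?h)) > 0" if "poly Q w = 0" for w
        using rQ[OF that] 2 by simp
    qed (use assms nz in auto)
    then show False using assms by simp
  next
    case 3
    \<comment> \<open>The left end of the overlap of the two real intervals; a real point suffices,
      since strips constrain only real parts.\<close>
    define x where "x = max a (a' + ?h)"
    have "complex_of_real x \<in> root_strip P"
      using 3 by (auto simp: P(1) strip_def x_def)
    moreover have "complex_of_real (x - ?h) \<in> root_strip Q"
      using 3 by (auto simp: Q(1) strip_def x_def)
    moreover have "complex_of_real x = complex_of_real (x - ?h) + (of_nat n - 1) / 2" by simp
    ultimately show False using empty by blast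
  qed
qed

end
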